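(* The group $\langle H_2,K_1\rangle$, acting on $\mathbb{C}^2$ by polynomial automorphisms, acts infinitely transitively on its open orbit.
   Context: $H_2=\{(X,Y+aX^2)\mid a\in\mathbb{C}\}$ and $K_1=\{(X+aY,Y)\mid a\in\mathbb{C}\}$ are subgroups of the group of polynomial automorphisms of $\mathbb{C}^2$ (automorphisms are written as pairs of polynomials in $X,Y$), and $\langle H_2,K_1\rangle$ is the subgroup they generate. A group acts infinitely transitively on a set $S$ if for every integer $m\ge 1$ it acts transitively on the set of ordered $m$-tuples of pairwise distinct points of $S$. The open orbit is the (Zariski) open orbit of the group in $\mathbb{C}^2$. *)

theory Defs
  imports
    Complex_Main
    "HOL-Computational_Algebra.Polynomial"
    "HOL-Algebra.Generated_Groups"
    "HOL-Algebra.Group_Action"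
begin

section \<open>Polynomials in two variables\<close>

text \<open>
  The ring \<open>\<complex>[X, Y]\<close> is rendered as \<open>(\<complex>[X])[Y]\<close>: the outer indeterminate is \<open>Y\<close>,
  the inner one (that of the coefficients) is \<open>X\<close>.
\<close>

type_synonym bipoly = "complex poly poly"

definition const2 :: "complex \<Rightarrow> bipoly"
  where "const2 a = [:[:a:]:]"

definition varX :: bipoly
  where "varX = [:[:0, 1:]:]"

definition varY :: bipoly
  where "varY = [:0, 1:]"

definition eval2 :: "bipoly \<Rightarrow> complex \<times> complex \<Rightarrow> complex"
  where "eval2 p z = poly (map_poly (\<lambda>q. poly q (fst z)) p) (snd z)"

text \<open>\<open>subst2 p (F\<^sub>1, F\<^sub>2)\<close> is the polynomial \<open>p(F\<^sub>1, F\<^sub>2)\<close>.\<close>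

definition subst2 :: "bipoly \<Rightarrow> bipoly \<times> bipoly \<Rightarrow> bipoly"
  where "subst2 p F = poly (map_poly (\<lambda>q. poly (map_poly const2 q) (fst F)) p) (snd F)"


section \<open>Polynomial automorphisms of the plane\<close>

text \<open>
  The monoid of polynomial endomorphisms of \<open>\<complex>\<^sup>2\<close>, whose product \<open>F \<otimes> G\<close> is the
  composition \<open>F \<circ> G\<close>; its invertible elements are the polynomial automorphisms.
\<close>

definition poly_End :: "(bipoly \<times> bipoly) monoid"
  where "poly_End =
    \<lparr>carrier = UNIV,
     mult = \<lambda>F G. (subst2 (fst F) G, subst2 (snd F) G),
     one = (varX, varY)\<rparr>"

definition poly_Aut :: "(bipoly \<times> bipoly) monoid"
  where "poly_Aut = units_of poly_End"

definition act :: "bipoly \<times> bipoly \<Rightarrow> complex \<times> complex \<Rightarrow> complex \<times> complex"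
  where "act F z = (eval2 (fst F) z, eval2 (snd F) z)"

definition H2 :: "(bipoly \<times> bipoly) set"
  where "H2 = {(varX, varY + const2 a * varX ^ 2) | a. True}"

definition K1 :: "(bipoly \<times> bipoly) set"
  where "K1 = {(varX + const2 a * varY, varY) | a. True}"

definition grp_H2_K1 :: "(bipoly \<times> bipoly) monoid"
  where "grp_H2_K1 = poly_Aut\<lparr>carrier := generate poly_Aut (H2 \<union> K1)\<rparr>"


section \<open>Zariski topology and open orbits\<close>

definition zariski_closed :: "(complex \<times> complex) set \<Rightarrow> bool"
  where "zariski_closed S \<longleftrightarrow> (\<exists>P :: bipoly set. S = {z. \<forall>p\<in>P. eval2 p z = 0})"

definition zariski_open :: "(complex \<times> complex) set \<Rightarrow> bool"
  where "zariski_open S \<longleftrightarrow> zariski_closed (- S)"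

definition open_orbit :: "(bipoly \<times> bipoly) monoid \<Rightarrow> (complex \<times> complex) set \<Rightarrow> bool"
  where "open_orbit G S \<longleftrightarrow> S \<in> orbits G UNIV act \<and> zariski_open S"


section \<open>Infinite transitivity\<close>

definition distinct_tuples :: "nat \<Rightarrow> 'b set \<Rightarrow> 'b list set"
  where "distinct_tuples m S = {xs. length xs = m \<and> distinct xs \<and> set xs \<subseteq> S}"

text \<open>
  The group acts on tuples componentwise. The restriction is needed because the library's
  group of bijections of a set consists of extensional functions.
\<close>

definition infinitely_transitive ::
    "('a, 'c) monoid_scheme \<Rightarrow> ('a \<Rightarrow> 'b \<Rightarrow> 'b) \<Rightarrow> 'b set \<Rightarrow> bool"
  where "infinitely_transitive G \<phi> S \<longleftrightarrow>
    (\<forall>m\<ge>1. transitive_action G (distinct_tuples m S)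
             (\<lambda>g. restrict (map (\<phi> g)) (distinct_tuples m S)))"

end

theory Submission
  imports Defs "HOL-Analysis.Analysis"
begin

text \<open>
  Call a vector field \<open>V\<close> on the plane admissible if it is the velocity at \<open>t = 0\<close> of a family
  \<open>F\<^sub>t\<close> of elements of the group with \<open>F\<^sub>0 = id\<close>. Composition, rescaling of \<open>t\<close> and conjugation
  make the admissible fields a complex vector space that is stable under push-forward by the group.
  Starting from \<open>x\<^sup>2 \<partial>\<^sub>y\<close>, push-forwards produce all \<open>x\<^sup>k \<partial>\<^sub>y\<close> with \<open>k \<ge> 2\<close>, hence all shears
  \<open>Q(x - a y) (a \<partial>\<^sub>x + \<partial>\<^sub>y)\<close> with \<open>Q\<close> divisible by \<open>t\<^sup>2\<close>. For generic \<open>a\<close> the form \<open>x - a y\<close> separates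
  any given finitely many nonzero points from each other and from the origin, so admissible fields
  take arbitrary values at these points. By the inverse function theorem every sufficiently small
  displacement of the points is achieved by the group. Since the complement of a finite set in
  \<open>\<complex>\<^sup>2\<close> is connected, one point can then be moved anywhere while the others stay fixed, and tuples
  of nonzero points are matched one entry at a time.
\<close>

section \<open>Polynomial maps and their action\<close>

lemma eval2_0 [simp]: "eval2 0 z = 0"
  by (simp add: eval2_def)

lemma eval2_pCons: "eval2 (pCons q p) z = poly q (fst z) + snd z * eval2 p z"
  by (simp add: eval2_def map_poly_pCons)

lemma eval2_add [simp]: "eval2 (p + q) z = eval2 p z + eval2 q z"
  by (induction p q rule: poly_induct2) (simp_all add: eval2_pCons algebra_simps)

lemma eval2_smult [simp]: "eval2 (smult c p) z = poly c (fst z) * eval2 p z"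
  by (induction p) (simp_all add: eval2_pCons algebra_simps)

lemma eval2_mult [simp]: "eval2 (p * q) z = eval2 p z * eval2 q z"
  by (induction p) (simp_all add: eval2_pCons algebra_simps)

lemma eval2_generators [simp]:
  "eval2 1 z = 1" "eval2 (const2 a) z = a" "eval2 varX z = fst z" "eval2 varY z = snd z"
  by (simp_all add: one_pCons eval2_pCons const2_def varX_def varY_def)

lemma eval2_power [simp]: "eval2 (p ^ n) z = eval2 p z ^ n"
  by (induction n) simp_all

text \<open>A nonzero polynomial in one variable has finitely many roots in the infinite field of
  complex numbers. This is applied first in \<open>Y\<close> with \<open>x\<close> fixed, then in
  \<open>X\<close> to each coefficient.\<close>

lemma eval2_inject:
  assumes "\<And>z. eval2 p z = eval2 q z"
  shows "p = q"
proof -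
  have zero: "r = 0" if "\<And>z. eval2 r z = 0" for r
  proof -
    have "map_poly (\<lambda>q. poly q x) r = 0" for x
    proof -
      have "poly (map_poly (\<lambda>q. poly q x) r) = poly 0"
        using that[of "(x, _)"] by (auto simp: eval2_def fun_eq_iff)
      then show ?thesis by (simp only: poly_eq_poly_eq_iff)
    qed
    then have "poly (coeff r n) x = 0" for n x
      by (metis coeff_0 coeff_map_poly poly_0)
    then have "coeff r n = 0" for n
      by (metis poly_0 poly_eq_poly_eq_iff ext)
    then show ?thesis by (simp add: poly_eq_iff)
  qed
  have "eval2 (p - q) z = 0" for z
    using eval2_add[of "p - q" q z] by (simp add: assms)
  then have "p - q = 0" by (rule zero)
  then show ?thesis by simp
qed

lemma eval2_subst2: "eval2 (subst2 p F) z = eval2 p (act F z)"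
proof -
  have inner: "eval2 (poly (map_poly const2 q) G) z = poly q (eval2 G z)" for q G
    by (induction q) (simp_all add: map_poly_pCons const2_def[of 0])
  show ?thesis
    unfolding subst2_def
    by (induction p) (simp_all add: map_poly_pCons inner eval2_pCons act_def)
qed

lemma act_inject: "act F = act G \<longleftrightarrow> F = G"
  by (auto simp: act_def fun_eq_iff prod_eq_iff intro!: eval2_inject)

lemma act_mult [simp]: "act (F \<otimes>\<^bsub>poly_End\<^esub> G) = act F \<circ> act G"
  by (auto simp: act_def poly_End_def eval2_subst2 fun_eq_iff)

lemma act_one [simp]: "act \<one>\<^bsub>poly_End\<^esub> = id"
  by (auto simp: act_def poly_End_def fun_eq_iff)

text \<open>Associativity of substitution is inherited from composition of functions, because
  \<open>act\<close> is injective and turns the product into composition.\<close>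

lemma monoid_poly_End: "monoid poly_End"
proof
  fix F G H
  show "F \<otimes>\<^bsub>poly_End\<^esub> G \<otimes>\<^bsub>poly_End\<^esub> H = F \<otimes>\<^bsub>poly_End\<^esub> (G \<otimes>\<^bsub>poly_End\<^esub> H)"
    by (simp add: act_inject[symmetric] comp_assoc)
  show "\<one>\<^bsub>poly_End\<^esub> \<otimes>\<^bsub>poly_End\<^esub> F = F" "F \<otimes>\<^bsub>poly_End\<^esub> \<one>\<^bsub>poly_End\<^esub> = F"
    by (simp_all add: act_inject[symmetric])
qed (simp_all add: poly_End_def)

lemma group_poly_Aut: "group poly_Aut"
  unfolding poly_Aut_def by (rule monoid.units_group[OF monoid_poly_End])

section \<open>The group as a set of bijections of the plane\<close>

type_synonym plane = "complex \<times> complex"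

definition hmap :: "complex \<Rightarrow> plane \<Rightarrow> plane"
  where "hmap a z = (fst z, snd z + a * fst z ^ 2)"

definition kmap :: "complex \<Rightarrow> plane \<Rightarrow> plane"
  where "kmap a z = (fst z + a * snd z, snd z)"

lemma hmap_hmap [simp]: "hmap a (hmap (-a) z) = z" "hmap (-a) (hmap a z) = z"
  and kmap_kmap [simp]: "kmap a (kmap (-a) z) = z" "kmap (-a) (kmap a z) = z"
  by (simp_all add: hmap_def kmap_def)

lemma act_H2: "act (varX, varY + const2 a * varX ^ 2) = hmap a"
  and act_K1: "act (varX + const2 a * varY, varY) = kmap a"
  by (simp_all add: act_def hmap_def kmap_def fun_eq_iff)

lemma generators_subset: "H2 \<union> K1 \<subseteq> carrier poly_Aut"
proof -
  have UnitsI: "F \<in> Units poly_End" if "act F \<circ> act G = id" "act G \<circ> act F = id" for F G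
    using that unfolding Units_def
    by (auto simp: act_inject[symmetric] poly_End_def[THEN arg_cong[of _ _ carrier]] simp del: split_paired_Ex)
  have 1: "(varX, varY + const2 a * varX ^ 2) \<in> Units poly_End" for a
    by (rule UnitsI[of _ "(varX, varY + const2 (-a) * varX ^ 2)"])
      (simp_all only: act_H2 fun_eq_iff comp_apply hmap_hmap id_apply simp_thms minus_minus)
  have 2: "(varX + const2 a * varY, varY) \<in> Units poly_End" for a
    by (rule UnitsI[of _ "(varX + const2 (-a) * varY, varY)"])
      (simp_all only: act_K1 fun_eq_iff comp_apply kmap_kmap id_apply simp_thms minus_minus)
  show ?thesis
    using 1 2 by (auto simp: H2_def K1_def poly_Aut_def units_of_carrier)
qed

lemma group_grp_H2_K1: "group grp_H2_K1"
  unfolding grp_H2_K1_def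
  using group.generate_is_subgroup[OF group_poly_Aut generators_subset]
  by (rule subgroup.subgroup_is_group[OF _ group_poly_Aut])

lemma act_grp_mult [simp]: "act (F \<otimes>\<^bsub>grp_H2_K1\<^esub> G) = act F \<circ> act G"
  and act_grp_one [simp]: "act \<one>\<^bsub>grp_H2_K1\<^esub> = id"
  using act_mult act_one
  by (simp_all add: grp_H2_K1_def poly_Aut_def units_of_mult units_of_one)

text \<open>As \<open>act\<close> is faithful and multiplicative, nothing is lost by replacing
  polynomial pairs with the maps they induce, and analysis applies to the latter.\<close>

definition grp_maps :: "(plane \<Rightarrow> plane) set"
  where "grp_maps = act ` carrier grp_H2_K1"

lemma id_grp_maps [simp]: "id \<in> grp_maps"
  unfolding grp_maps_def
  by (metis act_grp_one group.is_monoid group_grp_H2_K1 image_eqI monoid.one_closed)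

lemma comp_grp_maps: "f \<in> grp_maps \<Longrightarrow> g \<in> grp_maps \<Longrightarrow> f \<circ> g \<in> grp_maps"
  unfolding grp_maps_def
  by (metis (no_types, lifting) act_grp_mult group.is_monoid group_grp_H2_K1 image_iff
      monoid.m_closed)

lemma inverse_grp_maps:
  assumes "f \<in> grp_maps"
  obtains g where "g \<in> grp_maps" "g \<circ> f = id" "f \<circ> g = id"
proof -
  interpret group grp_H2_K1 by (rule group_grp_H2_K1)
  obtain F where F: "F \<in> carrier grp_H2_K1" "f = act F"
    using assms by (auto simp: grp_maps_def)
  show ?thesis
    by (rule that[of "act (inv\<^bsub>grp_H2_K1\<^esub> F)"])
      (use F in \<open>auto simp: grp_maps_def simp del: act_grp_mult simp flip: act_grp_mult\<close>)
qed

lemma hmap_grp_maps [simp]: "hmap a \<in> grp_maps"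
  and kmap_grp_maps [simp]: "kmap a \<in> grp_maps"
proof -
  have "(varX, varY + const2 a * varX ^ 2) \<in> carrier grp_H2_K1"
    "(varX + const2 a * varY, varY) \<in> carrier grp_H2_K1"
    by (auto simp: grp_H2_K1_def H2_def K1_def intro!: generate.incl)
  then show "hmap a \<in> grp_maps" "kmap a \<in> grp_maps"
    unfolding grp_maps_def by (auto simp flip: act_H2 act_K1)
qed

lemma grp_maps_bij: "f \<in> grp_maps \<Longrightarrow> bij f"
  by (metis inverse_grp_maps o_bij)

text \<open>The generators have no constant terms. The origin is therefore an orbit of its own and
  has to be avoided by all points that are to be moved.\<close>

lemma grp_maps_fix_0:
  assumes "f \<in> grp_maps"
  shows "f 0 = 0"
proof -
  interpret Aut: group poly_Aut by (rule group_poly_Aut)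
  interpret End: monoid poly_End by (rule monoid_poly_End)
  have gen: "act F 0 = 0" if "F \<in> H2 \<union> K1" for F
    using that by (auto simp: H2_def K1_def act_def zero_prod_def)
  have "act F 0 = 0" if "F \<in> generate poly_Aut (H2 \<union> K1)" for F
    using that
  proof induction
    case one
    show ?case by (simp add: poly_Aut_def units_of_one)
  next
    case (incl F)
    then show ?case by (rule gen)
  next
    \<comment> \<open>Since \<open>F\<close> fixes the origin, evaluating (inverse of
      \<open>F\<close>) o \<open>F\<close> = \<open>id\<close> there settles the inverse.\<close>
    case (inv F)
    then have "inv\<^bsub>poly_Aut\<^esub> F \<otimes>\<^bsub>poly_Aut\<^esub> F = \<one>\<^bsub>poly_Aut\<^esub>"
      using generators_subset by (blast intro: Aut.l_inv)
    then have "act (inv\<^bsub>poly_Aut\<^esub> F) \<circ> act F = id"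
      unfolding poly_Aut_def units_of_mult units_of_one by (metis act_mult act_one)
    then show ?case
      using gen[OF inv] by (metis comp_apply id_apply)
  next
    case (eng F G)
    then show ?case by (simp add: poly_Aut_def units_of_mult)
  qed
  then show ?thesis
    using assms by (auto simp: grp_maps_def grp_H2_K1_def)
qed

section \<open>Strict derivatives\<close>

text \<open>Both \<open>u\<close> and \<open>v\<close> vary near \<open>x\<close>, unlike in a
  Frechet derivative. This two-point estimate, needed at a single \<open>x\<close> only, yields the
  contraction in \<open>locally_onto\<close> without any derivative at neighbouring points.\<close>

definition has_strict_derivative ::
    "('a::real_normed_vector \<Rightarrow> 'b::real_normed_vector) \<Rightarrow> ('a \<Rightarrow> 'b) \<Rightarrow> 'a \<Rightarrow> bool"
  where "has_strict_derivative f f' x \<longleftrightarrow> bounded_linear f' \<and>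
    (\<forall>e>0. \<exists>d>0. \<forall>u\<in>ball x d. \<forall>v\<in>ball x d. norm (f u - f v - f' (u - v)) \<le> e * norm (u - v))"

lemma has_strict_derivativeD:
  assumes "has_strict_derivative f f' x" "e > 0"
  obtains d where "d > 0"
    "\<And>u v. u \<in> ball x d \<Longrightarrow> v \<in> ball x d \<Longrightarrow> norm (f u - f v - f' (u - v)) \<le> e * norm (u - v)"
  using assms unfolding has_strict_derivative_def by blast

lemma has_strict_derivative_linear: "bounded_linear f \<Longrightarrow> has_strict_derivative f f x"
  unfolding has_strict_derivative_def
  by (auto simp: linear_diff[OF bounded_linear.linear] intro!: exI[of _ 1])

lemma has_strict_derivative_const: "has_strict_derivative (\<lambda>_. c) (\<lambda>_. 0) x"
  by (auto simp: has_strict_derivative_def intro: exI[of _ 1])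

lemma has_strict_derivative_Pair:
  assumes f: "has_strict_derivative f f' x" and g: "has_strict_derivative g g' x"
  shows "has_strict_derivative (\<lambda>x. (f x, g x)) (\<lambda>h. (f' h, g' h)) x"
  unfolding has_strict_derivative_def
proof (intro conjI allI impI)
  show "bounded_linear (\<lambda>h. (f' h, g' h))"
    using f g by (auto simp: has_strict_derivative_def intro: bounded_linear_Pair)
next
  fix e :: real assume "e > 0"
  then have e: "e / 2 > 0" by simp
  obtain d1 where d1: "d1 > 0"
    "\<And>u v. u \<in> ball x d1 \<Longrightarrow> v \<in> ball x d1 \<Longrightarrow> norm (f u - f v - f' (u - v)) \<le> e/2 * norm (u - v)"
    using has_strict_derivativeD[OF f e] by blast
  obtain d2 where d2: "d2 > 0"
    "\<And>u v. u \<in> ball x d2 \<Longrightarrow> v \<in> ball x d2 \<Longrightarrow> norm (g u - g v - g' (u - v)) \<le> e/2 * norm (u - v)"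
    using has_strict_derivativeD[OF g e] by blast
  show "\<exists>d>0. \<forall>u\<in>ball x d. \<forall>v\<in>ball x d.
      norm ((f u, g u) - (f v, g v) - (f' (u - v), g' (u - v))) \<le> e * norm (u - v)"
  proof (intro exI[of _ "min d1 d2"] conjI ballI)
    fix u v assume "u \<in> ball x (min d1 d2)" "v \<in> ball x (min d1 d2)"
    then have "norm (f u - f v - f' (u - v)) + norm (g u - g v - g' (u - v)) \<le> e * norm (u - v)"
      using d1(2)[of u v] d2(2)[of u v] by auto
    then show "norm ((f u, g u) - (f v, g v) - (f' (u - v), g' (u - v))) \<le> e * norm (u - v)"
      by (simp add: order_trans[OF norm_Pair_le])
  qed (use d1 d2 in auto)
qed

lemma has_strict_derivative_compose:
  assumes f: "has_strict_derivative f f' x" and g: "has_strict_derivative g g' (f x)"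
  shows "has_strict_derivative (\<lambda>x. g (f x)) (\<lambda>h. g' (f' h)) x"
  unfolding has_strict_derivative_def
proof (intro conjI allI impI)
  have bl: "bounded_linear f'" "bounded_linear g'"
    using f g by (auto simp: has_strict_derivative_def)
  then show "bounded_linear (\<lambda>h. g' (f' h))"
    by (rule bounded_linear_compose[rotated])
  obtain M where M: "M > 0" "\<And>h. norm (f' h) \<le> norm h * M"
    using bounded_linear.pos_bounded[OF bl(1)] by blast
  obtain N where N: "N > 0" "\<And>h. norm (g' h) \<le> norm h * N"
    using bounded_linear.pos_bounded[OF bl(2)] by blast
  fix e :: real assume e: "e > 0"
  \<comment> \<open>The error of \<open>g\<close> gets scaled by a Lipschitz constant of
    \<open>f\<close>, the error of \<open>f\<close> by the bound \<open>N\<close> of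
    \<open>g'\<close>; each product may take half of \<open>e\<close>. The cap 1 in
    \<open>e1\<close> makes \<open>M + 1\<close> such a Lipschitz constant near
    \<open>x\<close>.\<close>
  define e1 where "e1 = min 1 (e / (2 * N))"
  define e2 where "e2 = e / (2 * (M + 1))"
  have e1: "e1 > 0" and e2: "e2 > 0"
    using e M N by (auto simp: e1_def e2_def)
  obtain d2 where d2: "d2 > 0" "\<And>u v. u \<in> ball (f x) d2 \<Longrightarrow> v \<in> ball (f x) d2 \<Longrightarrow>
      norm (g u - g v - g' (u - v)) \<le> e2 * norm (u - v)"
    using has_strict_derivativeD[OF g e2] by blast
  obtain d1 where d1: "d1 > 0" "\<And>u v. u \<in> ball x d1 \<Longrightarrow> v \<in> ball x d1 \<Longrightarrow>
      norm (f u - f v - f' (u - v)) \<le> e1 * norm (u - v)"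
    using has_strict_derivativeD[OF f e1] by blast
  have lip: "norm (f u - f v) \<le> (M + 1) * norm (u - v)" if "u \<in> ball x d1" "v \<in> ball x d1" for u v
  proof -
    have "norm (f u - f v) \<le> norm (f u - f v - f' (u - v)) + norm (f' (u - v))"
      by (metis add.commute diff_add_cancel norm_triangle_ineq)
    also have "\<dots> \<le> e1 * norm (u - v) + norm (u - v) * M"
      using d1(2)[OF that] M(2) by (intro add_mono)
    also have "\<dots> \<le> 1 * norm (u - v) + norm (u - v) * M"
      by (intro add_mono mult_right_mono) (use M in \<open>auto simp: e1_def\<close>)
    finally show ?thesis by (simp add: algebra_simps)
  qed
  define d where "d = min d1 (d2 / (M + 1))"
  show "\<exists>d>0. \<forall>u\<in>ball x d. \<forall>v\<in>ball x d.
      norm (g (f u) - g (f v) - g' (f' (u - v))) \<le> e * norm (u - v)"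
  proof (intro exI[of _ d] conjI ballI)
    show "d > 0" using d1 d2 M by (simp add: d_def)
    fix u v assume uv: "u \<in> ball x d" "v \<in> ball x d"
    then have uv1: "u \<in> ball x d1" "v \<in> ball x d1" by (auto simp: d_def)
    have fd2: "f w \<in> ball (f x) d2" if "w \<in> ball x d" for w
    proof -
      have "dist (f x) (f w) \<le> (M + 1) * dist x w"
        using lip[of x w] that d1(1) by (simp add: d_def dist_norm)
      also have "\<dots> < (M + 1) * (d2 / (M + 1))"
        using that M by (intro mult_strict_left_mono) (auto simp: d_def)
      finally show ?thesis using M by simp
    qed
    have "norm (g (f u) - g (f v) - g' (f' (u - v)))
      = norm ((g (f u) - g (f v) - g' (f u - f v)) + g' (f u - f v - f' (u - v)))"
      by (simp add: linear_diff[OF bounded_linear.linear[OF bl(2)]])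
    also have "\<dots> \<le> e2 * norm (f u - f v) + norm (f u - f v - f' (u - v)) * N"
      using d2(2)[OF fd2[OF uv(1)] fd2[OF uv(2)]] N(2) by (intro norm_triangle_le add_mono)
    also have "\<dots> \<le> e2 * ((M + 1) * norm (u - v)) + (e1 * norm (u - v)) * N"
      using lip[OF uv1] d1(2)[OF uv1] e2 N(1) by (intro add_mono mult_left_mono mult_right_mono) auto
    also have "\<dots> = (e2 * (M + 1) + e1 * N) * norm (u - v)"
      by (simp add: algebra_simps)
    also have "\<dots> \<le> (e / 2 + e / 2) * norm (u - v)"
    proof (intro mult_right_mono add_mono)
      show "e2 * (M + 1) \<le> e / 2" using M by (simp add: e2_def field_simps)
      have "e1 * N \<le> e / (2 * N) * N" using N by (intro mult_right_mono) (auto simp: e1_def)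
      then show "e1 * N \<le> e / 2" using N by simp
    qed auto
    finally show "norm (g (f u) - g (f v) - g' (f' (u - v))) \<le> e * norm (u - v)" by simp
  qed
qed

lemma has_strict_derivative_add:
  assumes f: "has_strict_derivative f f' x" and g: "has_strict_derivative g g' x"
  shows "has_strict_derivative (\<lambda>x. f x + g x) (\<lambda>h. f' h + g' h) x"
  using has_strict_derivative_compose[OF has_strict_derivative_Pair[OF f g]
      has_strict_derivative_linear[of "\<lambda>w. fst w + snd w"]]
  by (simp add: bounded_linear_add bounded_linear_fst bounded_linear_snd)

text \<open>By the chain rule only multiplication on pairs has to be treated. Its remainder at
  \<open>(a, b)\<close> is \<open>fst (u - v) * (snd u - b) + (fst v - a) * snd (u - v)\<close>,
  where every product has a small factor.\<close>

lemma has_strict_derivative_mult: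
  fixes f g :: "'a::real_normed_vector \<Rightarrow> 'b::real_normed_field"
  assumes f: "has_strict_derivative f f' x" and g: "has_strict_derivative g g' x"
  shows "has_strict_derivative (\<lambda>x. f x * g x) (\<lambda>h. f x * g' h + f' h * g x) x"
proof -
  have "has_strict_derivative (\<lambda>w. fst w * snd w) (\<lambda>h. a * snd h + fst h * b) (a, b)" for a b :: 'b
    unfolding has_strict_derivative_def
  proof (intro conjI allI impI)
    show "bounded_linear (\<lambda>h. a * snd h + fst h * b)"
      by (intro bounded_linear_add bounded_linear_const_mult bounded_linear_mult_const
          bounded_linear_fst bounded_linear_snd)
    fix e :: real assume "e > 0"
    show "\<exists>d>0. \<forall>u\<in>ball (a, b) d. \<forall>v\<in>ball (a, b) d.
      norm (fst u * snd u - fst v * snd v - (a * snd (u - v) + fst (u - v) * b)) \<le> e * norm (u - v)"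
    proof (intro exI[of _ "e / 2"] conjI ballI)
      fix u v assume uv: "u \<in> ball (a, b) (e/2)" "v \<in> ball (a, b) (e/2)"
      have "norm (snd u - b) \<le> e / 2"
        using uv(1) dist_snd_le[of u "(a, b)"] by (simp add: dist_norm norm_minus_commute)
      moreover have "norm (fst v - a) \<le> e / 2"
        using uv(2) dist_fst_le[of v "(a, b)"] by (simp add: dist_norm norm_minus_commute)
      moreover have "norm (fst (u - v)) \<le> norm (u - v)" "norm (snd (u - v)) \<le> norm (u - v)"
        using dist_fst_le[of u v] dist_snd_le[of u v] by (simp_all add: dist_norm)
      ultimately have "norm (fst (u - v)) * norm (snd u - b) + norm (fst v - a) * norm (snd (u - v))
        \<le> norm (u - v) * (e / 2) + e / 2 * norm (u - v)"
        using \<open>e > 0\<close> by (intro add_mono mult_mono) auto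
      moreover have "fst u * snd u - fst v * snd v - (a * snd (u - v) + fst (u - v) * b)
        = fst (u - v) * (snd u - b) + (fst v - a) * snd (u - v)"
        by (simp add: algebra_simps)
      ultimately show "norm (fst u * snd u - fst v * snd v - (a * snd (u - v) + fst (u - v) * b))
        \<le> e * norm (u - v)"
        by (simp add: norm_triangle_le norm_mult)
    qed (use \<open>e > 0\<close> in auto)
  qed
  from has_strict_derivative_compose[OF has_strict_derivative_Pair[OF f g] this] show ?thesis
    by simp
qed

section \<open>Local surjectivity by the Banach fixed point theorem\<close>

text \<open>
  The library has completeness of \<open>'a \<Rightarrow>\<^sub>C 'b\<close> only for \<open>'a\<close> of class \<open>metric_space\<close>,
  of which \<open>nat\<close> is not an instance.
\<close>

lemma complete_bcontfun_nat: "complete (UNIV :: (nat \<Rightarrow>\<^sub>C 'b::complete_space) set)"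
proof (rule completeI)
  fix f :: "nat \<Rightarrow> nat \<Rightarrow>\<^sub>C 'b" assume "Cauchy f"
  then have "uniformly_Cauchy_on UNIV (\<lambda>n. apply_bcontfun (f n))"
    unfolding Cauchy_def uniformly_Cauchy_on_def by (meson dist_bounded le_less_trans)
  then have "uniformly_convergent_on UNIV (\<lambda>n. apply_bcontfun (f n))"
    by (rule Cauchy_uniformly_convergent)
  then obtain l where "uniform_limit UNIV (\<lambda>n. apply_bcontfun (f n)) l sequentially"
    by (auto simp: uniformly_convergent_on_def)
  from uniform_limit_bcontfunE[OF this sequentially_bot] show "\<exists>l\<in>UNIV. f \<longlonglongrightarrow> l"
    by (metis UNIV_I)
qed

text \<open>
  The inverse function theorem in dimensions that vary with \<open>m\<close>: sequences under the supremum
  norm serve as a single parameter space for all \<open>m\<close>.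
\<close>

lemma locally_onto:
  fixes \<phi> :: "nat \<Rightarrow> (nat \<Rightarrow>\<^sub>C 'b::banach) \<Rightarrow> 'b"
  assumes \<phi>: "\<And>i. i < m \<Longrightarrow> has_strict_derivative (\<phi> i) (\<lambda>t. apply_bcontfun t i) 0"
  obtains \<delta> where "\<delta> > 0"
    "\<And>q. (\<And>i. i < m \<Longrightarrow> dist (q i) (\<phi> i 0) < \<delta>) \<Longrightarrow> \<exists>t. \<forall>i<m. \<phi> i t = q i"
proof -
  have "\<forall>i. \<exists>d>0. i < m \<longrightarrow> (\<forall>u\<in>ball 0 d. \<forall>v\<in>ball 0 d.
      norm (\<phi> i u - \<phi> i v - apply_bcontfun (u - v) i) \<le> 1/2 * norm (u - v))"
    using \<phi> unfolding has_strict_derivative_def by (metis half_gt_zero_iff zero_less_one)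
  then obtain d where d: "\<And>i. d i > 0" "\<And>i u v. i < m \<Longrightarrow> u \<in> ball 0 (d i) \<Longrightarrow> v \<in> ball 0 (d i) \<Longrightarrow>
      norm (\<phi> i u - \<phi> i v - apply_bcontfun (u - v) i) \<le> 1/2 * norm (u - v)"
    by metis
  \<comment> \<open>The entry 1 keeps the minimum defined for \<open>m = 0\<close>; halving puts the
    closed ball of radius \<open>r\<close> inside every open ball of radius
    \<open>d i\<close>.\<close>
  define r where "r = Min (insert 1 (d ` {..<m})) / 2"
  have "Min (insert 1 (d ` {..<m})) > 0"
    using d(1) by (subst Min_gr_iff) auto
  moreover have "Min (insert 1 (d ` {..<m})) \<le> d i" if "i < m" for i
    using that by (intro Min_le) auto
  ultimately have r: "r > 0" "\<And>i. i < m \<Longrightarrow> r < d i"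
    unfolding r_def by (force, metis field_sum_of_halves less_add_same_cancel1 half_gt_zero
        order_less_le_trans)
  have est: "norm (\<phi> i u - \<phi> i v - (apply_bcontfun u i - apply_bcontfun v i)) \<le> norm (u - v) / 2"
    if "i < m" "u \<in> cball 0 r" "v \<in> cball 0 r" for i u v
    using d(2)[OF that(1), of u v] that(2,3) r(2)[OF that(1)] by simp
  show ?thesis
  proof (rule that[of "r / 2"])
    show "r / 2 > 0" using r by simp
    fix q assume q: "\<And>i. i < m \<Longrightarrow> dist (q i) (\<phi> i 0) < r / 2"
    \<comment> \<open>A fixed point \<open>t\<close> of this correction step satisfies
      \<open>\<phi> i t = q i\<close> for \<open>i < m\<close>. As the derivative of
      \<open>\<phi> i\<close> at 0 is the \<open>i\<close>-th coordinate, the map is a contraction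
      near 0. The value 0 beyond \<open>m\<close> gives \<open>S t\<close> finite range, hence
      boundedness.\<close>
    define S where "S t i = (if i < m then apply_bcontfun t i - \<phi> i t + q i else 0)" for t i
    define T where "T t = Bcontfun (S t)" for t
    have T: "apply_bcontfun (T t) = S t" for t
      unfolding T_def
    proof (rule Bcontfun_inverse)
      have "range (S t) \<subseteq> insert 0 (S t ` {..<m})"
        by (auto simp: S_def)
      then have "finite (range (S t))"
        by (rule finite_subset) auto
      then show "S t \<in> bcontfun"
        by (auto simp: bcontfun_def finite_imp_bounded continuous_on_open_invariant open_discrete)
    qed
    have "\<exists>!t\<in>cball 0 r. T t = t"
    proof (rule Banach_fix[where c = "1/2"])
      show "complete (cball (0 :: nat \<Rightarrow>\<^sub>C 'b) r)"
        using complete_Int_closed[OF complete_bcontfun_nat closed_cball] by simp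
      show "cball 0 r \<noteq> ({} :: (nat \<Rightarrow>\<^sub>C 'b) set)"
        using r by simp
      show "T ` cball 0 r \<subseteq> cball 0 r"
      proof
        fix s assume "s \<in> T ` cball 0 r"
        then obtain t where t: "t \<in> cball 0 r" "s = T t" by blast
        have "norm (S t i) \<le> r" for i
        proof (cases "i < m")
          case True
          have "norm (S t i) = norm ((q i - \<phi> i 0) - (\<phi> i t - \<phi> i 0 - (apply_bcontfun t i - apply_bcontfun 0 i)))"
            using True by (simp add: S_def algebra_simps)
          also have "\<dots> \<le> norm (q i - \<phi> i 0) + norm (\<phi> i t - \<phi> i 0 - (apply_bcontfun t i - apply_bcontfun 0 i))"
            by (rule norm_triangle_ineq4)
          also have "\<dots> \<le> r / 2 + norm (t - 0) / 2"
            using q[OF True] est[OF True t(1), of 0] r by (intro add_mono) (auto simp: dist_norm)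
          finally show ?thesis using t by simp
        qed (use r in \<open>simp add: S_def\<close>)
        then show "s \<in> cball 0 r"
          using t by (simp add: T norm_bound)
      qed
      fix u v :: "nat \<Rightarrow>\<^sub>C 'b" assume uv: "u \<in> cball 0 r" "v \<in> cball 0 r"
      have "dist (S u i) (S v i) \<le> dist u v / 2" for i
      proof (cases "i < m")
        case True
        have "dist (S u i) (S v i) = norm (\<phi> i u - \<phi> i v - (apply_bcontfun u i - apply_bcontfun v i))"
          using True by (subst norm_minus_commute) (simp add: S_def dist_norm algebra_simps)
        then show ?thesis
          using est[OF True] uv by (simp add: dist_norm)
      qed (simp add: S_def)
      then show "dist (T u) (T v) \<le> 1/2 * dist u v"
        by (intro dist_bound) (simp add: T)
    qed auto
    then obtain t where "T t = t" by blast
    then have "S t i = apply_bcontfun t i" for i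
      using T[of t] by simp
    then have fixpoint: "apply_bcontfun t i - \<phi> i t + q i = apply_bcontfun t i" if "i < m" for i
      using that by (metis S_def)
    have "\<phi> i t = q i" if "i < m" for i
    proof -
      have "q i = (apply_bcontfun t i - \<phi> i t + q i) - (apply_bcontfun t i - \<phi> i t)"
        by simp
      also have "\<dots> = \<phi> i t"
        unfolding fixpoint[OF that] by simp
      finally show ?thesis by simp
    qed
    then show "\<exists>t. \<forall>i<m. \<phi> i t = q i" by blast
  qed
qed

section \<open>Velocity fields of curves in the group\<close>

text \<open>The derivative is taken jointly in parameter and point, so that the chain rule covers
  compositions of families; its linearity forces \<open>L z\<close> to be linear. The parameter
  space is left open: complex numbers serve for one field, sequences for moving many points
  independently.\<close>

definition velocity :: "(plane \<Rightarrow> 'e::real_normed_vector \<Rightarrow> plane) \<Rightarrow> bool"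
  where "velocity L \<longleftrightarrow> (\<exists>F. (\<forall>t. F t \<in> grp_maps) \<and> F 0 = id \<and>
    (\<forall>z. has_strict_derivative (\<lambda>w. F (fst w) (snd w)) (\<lambda>h. snd h + L z (fst h)) (0, z)))"

lemma velocity_0: "velocity (\<lambda>z t. 0)"
  unfolding velocity_def
  by (intro exI[of _ "\<lambda>_. id"]) (auto intro: has_strict_derivative_linear bounded_linear_snd)

text \<open>Both families are the identity at parameter 0, so the first-order terms of
  \<open>F t \<circ> G t\<close> add up.\<close>

lemma velocity_add:
  assumes "velocity L" "velocity M"
  shows "velocity (\<lambda>z t. L z t + M z t)"
proof -
  obtain F where F: "\<And>t. F t \<in> grp_maps" "F 0 = id"
    "\<And>z. has_strict_derivative (\<lambda>w. F (fst w) (snd w)) (\<lambda>h. snd h + L z (fst h)) (0, z)"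
    using assms(1) unfolding velocity_def by blast
  obtain G where G: "\<And>t. G t \<in> grp_maps" "G 0 = id"
    "\<And>z. has_strict_derivative (\<lambda>w. G (fst w) (snd w)) (\<lambda>h. snd h + M z (fst h)) (0, z)"
    using assms(2) unfolding velocity_def by blast
  have "has_strict_derivative (\<lambda>w. F (fst w) (G (fst w) (snd w)))
      (\<lambda>h. snd h + (L z (fst h) + M z (fst h))) (0, z)" for z
  proof -
    have "has_strict_derivative (\<lambda>w. (fst w, G (fst w) (snd w))) (\<lambda>h. (fst h, snd h + M z (fst h))) (0, z)"
      by (intro has_strict_derivative_Pair has_strict_derivative_linear bounded_linear_fst G)
    moreover have "has_strict_derivative (\<lambda>w. F (fst w) (snd w)) (\<lambda>h. snd h + L z (fst h))
        (fst (0, z), G (fst (0, z)) (snd (0, z)))"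
      using F(3)[of z] by (simp add: G)
    ultimately show ?thesis
      using has_strict_derivative_compose by (fastforce simp: algebra_simps)
  qed
  then show ?thesis
    unfolding velocity_def using F G
    by (intro exI[of _ "\<lambda>t. F t \<circ> G t"]) (auto intro: comp_grp_maps)
qed

lemma velocity_sum:
  assumes "finite I" "\<And>i. i \<in> I \<Longrightarrow> velocity (L i)"
  shows "velocity (\<lambda>z t. \<Sum>i\<in>I. L i z t)"
  using assms by induction (auto intro: velocity_0 velocity_add)

lemma velocity_reparametrize:
  assumes "velocity L" "bounded_linear \<rho>"
  shows "velocity (\<lambda>z t. L z (\<rho> t))"
proof -
  obtain F where F: "\<And>t. F t \<in> grp_maps" "F 0 = id"
    "\<And>z. has_strict_derivative (\<lambda>w. F (fst w) (snd w)) (\<lambda>h. snd h + L z (fst h)) (0, z)"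
    using assms(1) unfolding velocity_def by blast
  have \<rho>0: "\<rho> 0 = 0" using assms(2) by (simp add: linear_0 bounded_linear.linear)
  have "has_strict_derivative (\<lambda>w. F (\<rho> (fst w)) (snd w)) (\<lambda>h. snd h + L z (\<rho> (fst h))) (0, z)" for z
  proof -
    have "has_strict_derivative (\<lambda>w. (\<rho> (fst w), snd w)) (\<lambda>h. (\<rho> (fst h), snd h)) (0, z)"
      by (intro has_strict_derivative_linear bounded_linear_Pair bounded_linear_snd
          bounded_linear_compose[OF assms(2) bounded_linear_fst])
    moreover have "has_strict_derivative (\<lambda>w. F (fst w) (snd w)) (\<lambda>h. snd h + L z (fst h))
        (\<rho> (fst (0, z)), snd (0, z))"
      using F(3)[of z] by (simp add: \<rho>0)
    ultimately show ?thesis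
      using has_strict_derivative_compose by fastforce
  qed
  then show ?thesis
    unfolding velocity_def using F \<rho>0
    by (intro exI[of _ "\<lambda>t. F (\<rho> t)"]) auto
qed

text \<open>The family is \<open>g \<circ> F t \<circ> h\<close>, whose velocity is the push-forward
  of \<open>L\<close> by \<open>g\<close>. The assumption \<open>inv\<close> is the chain rule for
  \<open>g (h z) = z\<close>; it reduces the derivative in the point to the identity.\<close>

lemma velocity_conjugate:
  assumes L: "velocity L" and gh: "g \<in> grp_maps" "h \<in> grp_maps" "\<And>z. g (h z) = z"
    and g: "\<And>z. has_strict_derivative g (g' z) z" and h: "\<And>z. has_strict_derivative h (h' z) z"
    and inv: "\<And>z u. g' (h z) (h' z u) = u"
  shows "velocity (\<lambda>z t. g' (h z) (L (h z) t))"
proof -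
  obtain F where F: "\<And>t. F t \<in> grp_maps" "F 0 = id"
    "\<And>z. has_strict_derivative (\<lambda>w. F (fst w) (snd w)) (\<lambda>h. snd h + L z (fst h)) (0, z)"
    using L unfolding velocity_def by blast
  have "has_strict_derivative (\<lambda>w. g (F (fst w) (h (snd w))))
      (\<lambda>u. snd u + g' (h z) (L (h z) (fst u))) (0, z)" for z
  proof -
    have "has_strict_derivative h (h' z) (snd (0 :: 'a, z))"
      using h by simp
    then have "has_strict_derivative (\<lambda>w. h (snd w)) (\<lambda>u. h' z (snd u)) (0 :: 'a, z)"
      by (rule has_strict_derivative_compose[rotated])
        (intro has_strict_derivative_linear bounded_linear_snd)
    then have "has_strict_derivative (\<lambda>w. (fst w, h (snd w))) (\<lambda>u. (fst u, h' z (snd u))) (0 :: 'a, z)"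
      by (intro has_strict_derivative_Pair has_strict_derivative_linear bounded_linear_fst)
    moreover have "has_strict_derivative (\<lambda>w. F (fst w) (snd w)) (\<lambda>u. snd u + L (h z) (fst u))
        (fst (0, z), h (snd (0, z)))"
      using F(3)[of "h z"] by simp
    ultimately have "has_strict_derivative (\<lambda>w. F (fst w) (h (snd w)))
        (\<lambda>u. h' z (snd u) + L (h z) (fst u)) (0, z)"
      using has_strict_derivative_compose by fastforce
    moreover have "has_strict_derivative g (g' (h z)) (F (fst (0, z)) (h (snd (0, z))))"
      using g F(2) by simp
    ultimately have "has_strict_derivative (\<lambda>w. g (F (fst w) (h (snd w))))
        (\<lambda>u. g' (h z) (h' z (snd u) + L (h z) (fst u))) (0, z)"
      by (rule has_strict_derivative_compose)
    moreover have "linear (g' (h z))"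
      using g by (auto simp: has_strict_derivative_def bounded_linear.linear)
    ultimately show ?thesis
      by (simp add: linear_add inv)
  qed
  then show ?thesis
    unfolding velocity_def using F gh
    by (intro exI[of _ "\<lambda>t. g \<circ> F t \<circ> h"]) (auto intro!: comp_grp_maps)
qed

section \<open>Admissible fields: vector space structure and push-forward\<close>

definition cscale :: "complex \<Rightarrow> plane \<Rightarrow> plane"
  where "cscale c u = (c * fst u, c * snd u)"

text \<open>The time \<open>t\<close> is complex and acts through \<open>cscale\<close>, since the
  normed space \<open>plane\<close> is scaled by real numbers.\<close>

definition vfields :: "(plane \<Rightarrow> plane) set"
  where "vfields = {V. velocity (\<lambda>z t. cscale t (V z))}"

lemma vfields_add:
  assumes "V \<in> vfields" "W \<in> vfields"
  shows "(\<lambda>z. V z + W z) \<in> vfields"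
  using velocity_add[of "\<lambda>z t. cscale t (V z)" "\<lambda>z t. cscale t (W z)"] assms
  by (simp add: vfields_def cscale_def algebra_simps)

lemma vfields_scale:
  assumes "V \<in> vfields"
  shows "(\<lambda>z. cscale c (V z)) \<in> vfields"
  using velocity_reparametrize[OF _ bounded_linear_mult_right, of "\<lambda>z t. cscale t (V z)" c] assms
  by (simp add: vfields_def cscale_def mult_ac)

definition hmap_deriv :: "complex \<Rightarrow> plane \<Rightarrow> plane \<Rightarrow> plane"
  where "hmap_deriv a z u = (fst u, snd u + 2 * a * fst z * fst u)"

text \<open>The joint form serves twice: at \<open>t = 0\<close> it gives the velocity of the family
  \<open>hmap\<close>, and with the parameter frozen it gives the derivative needed for push-forward
  by \<open>hmap a\<close>.\<close>

lemma has_strict_derivative_hmap: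
  "has_strict_derivative (\<lambda>w. hmap (fst w) (snd w))
     (\<lambda>h. hmap_deriv t z (snd h) + (0, fst h * fst z ^ 2)) (t, z)"
proof -
  note lin = has_strict_derivative_linear
  have f: "has_strict_derivative (\<lambda>w. fst (snd w)) (\<lambda>h. fst (snd h)) (t, z)"
    by (intro lin bounded_linear_compose[OF bounded_linear_fst] bounded_linear_snd)
  have s: "has_strict_derivative (\<lambda>w. snd (snd w)) (\<lambda>h. snd (snd h)) (t, z)"
    by (intro lin bounded_linear_compose[OF bounded_linear_snd] bounded_linear_snd)
  from has_strict_derivative_Pair[OF f has_strict_derivative_add[OF s
        has_strict_derivative_mult[OF lin[OF bounded_linear_fst] has_strict_derivative_mult[OF f f]]]]
  show ?thesis
    by (simp add: hmap_def hmap_deriv_def power2_eq_square algebra_simps)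
qed

lemma has_strict_derivative_hmap_fixed: "has_strict_derivative (hmap a) (hmap_deriv a z) z"
proof -
  have "has_strict_derivative (\<lambda>z. (a, z)) (\<lambda>h. (0, h)) z"
    by (intro has_strict_derivative_Pair has_strict_derivative_const has_strict_derivative_linear
        bounded_linear_ident)
  from has_strict_derivative_compose[OF this has_strict_derivative_hmap] show ?thesis
    by (simp add: hmap_deriv_def[abs_def])
qed

lemma vfields_square: "(\<lambda>z. (0, fst z ^ 2)) \<in> vfields"
proof -
  have "velocity (\<lambda>z t. cscale t (0, fst z ^ 2))"
    unfolding velocity_def
  proof (intro exI[of _ hmap] conjI allI)
    show "has_strict_derivative (\<lambda>w. hmap (fst w) (snd w))
        (\<lambda>h. snd h + cscale (fst h) (0, fst z ^ 2)) (0, z)" for z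
      using has_strict_derivative_hmap[of 0 z] by (simp add: hmap_deriv_def cscale_def)
  qed (auto simp: hmap_def fun_eq_iff)
  then show ?thesis by (simp add: vfields_def)
qed

lemma vfields_hmap:
  assumes "V \<in> vfields"
  shows "(\<lambda>z. hmap_deriv a (hmap (-a) z) (V (hmap (-a) z))) \<in> vfields"
proof -
  have "velocity (\<lambda>z t. hmap_deriv a (hmap (-a) z) (cscale t (V (hmap (-a) z))))"
    using assms unfolding vfields_def mem_Collect_eq
    by (rule velocity_conjugate[OF _ hmap_grp_maps hmap_grp_maps hmap_hmap(1)
          has_strict_derivative_hmap_fixed has_strict_derivative_hmap_fixed])
      (simp_all add: vfields_def hmap_deriv_def hmap_def)
  then show ?thesis
    by (simp add: vfields_def hmap_deriv_def cscale_def algebra_simps)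
qed

lemma vfields_kmap:
  assumes "V \<in> vfields"
  shows "(\<lambda>z. kmap a (V (kmap (-a) z))) \<in> vfields"
proof -
  have "bounded_linear (kmap b)" for b
    unfolding kmap_def
    by (intro bounded_linear_Pair bounded_linear_add bounded_linear_const_mult
        bounded_linear_fst bounded_linear_snd)
  then have lin: "has_strict_derivative (kmap b) (kmap b) z" for b z
    by (rule has_strict_derivative_linear)
  have "velocity (\<lambda>z t. kmap a (cscale t (V (kmap (-a) z))))"
    using assms unfolding vfields_def mem_Collect_eq
    by (rule velocity_conjugate[OF _ kmap_grp_maps kmap_grp_maps kmap_kmap(1) lin lin]) simp
  then show ?thesis
    by (simp add: vfields_def kmap_def cscale_def algebra_simps)
qed

text \<open>Replacing \<open>a\<close> by \<open>2 * a\<close> and subtracting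
  \<open>2 ^ Suc n\<close> times the original cancels the top term and multiplies \<open>d j\<close>
  by \<open>2 ^ j - 2 ^ Suc n\<close>, which is nonzero for \<open>j \<le> n\<close>. Induction
  gives the lower coefficients; subtracting them at \<open>a = 1\<close> leaves the top one.\<close>

lemma vfields_coefficient:
  assumes "\<And>a. (\<lambda>z. \<Sum>j\<le>n. cscale (a ^ j) (d j z)) \<in> vfields" "j \<le> n"
  shows "d j \<in> vfields"
  using assms
proof (induction n arbitrary: d j)
  case 0
  then show ?case by (simp add: cscale_def)
next
  case (Suc n)
  have lower: "d j \<in> vfields" if "j \<le> n" for j
  proof -
    have "(\<lambda>z. (\<Sum>j\<le>Suc n. cscale ((2 * a) ^ j) (d j z))
        + cscale (- (2 ^ Suc n)) (\<Sum>j\<le>Suc n. cscale (a ^ j) (d j z))) \<in> vfields" for a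
      by (intro vfields_add vfields_scale Suc.prems)
    moreover have "(\<Sum>j\<le>Suc n. cscale ((2 * a) ^ j) (d j z))
        + cscale (- (2 ^ Suc n)) (\<Sum>j\<le>Suc n. cscale (a ^ j) (d j z))
      = (\<Sum>j\<le>n. cscale (a ^ j) (cscale (2 ^ j - 2 ^ Suc n) (d j z)))" for a z
    proof -
      have "cscale (- (2 ^ Suc n)) (\<Sum>j\<le>Suc n. cscale (a ^ j) (d j z))
        = (\<Sum>j\<le>Suc n. cscale (- (2 ^ Suc n)) (cscale (a ^ j) (d j z)))"
        by (simp only: cscale_def prod_eq_iff fst_sum snd_sum fst_conv snd_conv sum_distrib_left simp_thms)
      then have "(\<Sum>j\<le>Suc n. cscale ((2 * a) ^ j) (d j z))
        + cscale (- (2 ^ Suc n)) (\<Sum>j\<le>Suc n. cscale (a ^ j) (d j z))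
        = (\<Sum>j\<le>Suc n. cscale ((2 * a) ^ j) (d j z) + cscale (- (2 ^ Suc n)) (cscale (a ^ j) (d j z)))"
        by (simp only: sum.distrib)
      also have "\<dots> = (\<Sum>j\<le>Suc n. cscale (a ^ j) (cscale (2 ^ j - 2 ^ Suc n) (d j z)))"
        by (intro sum.cong) (simp_all add: cscale_def power_mult_distrib algebra_simps)
      finally show ?thesis by (simp add: cscale_def zero_prod_def[symmetric])
    qed
    ultimately have "(\<lambda>z. cscale (2 ^ j - 2 ^ Suc n) (d j z)) \<in> vfields"
      using that by (intro Suc.IH[of "\<lambda>j z. cscale (2 ^ j - 2 ^ Suc n) (d j z)"]) auto
    then have "(\<lambda>z. cscale (1 / (2 ^ j - 2 ^ Suc n)) (cscale (2 ^ j - 2 ^ Suc n) (d j z))) \<in> vfields"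
      by (rule vfields_scale)
    moreover have "(2::complex) ^ j - 2 ^ Suc n \<noteq> 0"
    proof -
      have "(2::nat) ^ j \<noteq> 2 ^ Suc n" using that by (subst power_inject_exp) auto
      then have "of_nat (2 ^ j) \<noteq> (of_nat (2 ^ Suc n) :: complex)" by (simp only: of_nat_eq_iff not_False_eq_True)
      then show ?thesis by simp
    qed
    ultimately show ?thesis by (simp add: cscale_def)
  qed
  show ?case
  proof (cases "j = Suc n")
    case True
    have "(\<lambda>z. \<Sum>j\<in>J. d j z) \<in> vfields" if "J \<subseteq> {..n}" for J
      using finite_subset[OF that finite_atMost] that
    proof (induction J)
      case empty
      then show ?case
        using vfields_scale[OF vfields_square, of 0] by (simp add: cscale_def zero_prod_def)
    next
      case (insert j J)
      then show ?case by (auto intro: vfields_add lower)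
    qed
    then have "(\<lambda>z. (\<Sum>j\<le>Suc n. cscale (1 ^ j) (d j z)) + cscale (-1) (\<Sum>j\<le>n. d j z)) \<in> vfields"
      by (intro vfields_add vfields_scale Suc.prems) auto
    moreover have "(\<Sum>j\<le>Suc n. cscale (1 ^ j) (d j z)) + cscale (-1) (\<Sum>j\<le>n. d j z) = d (Suc n) z" for z
      by (simp add: cscale_def prod_eq_iff)
    ultimately show ?thesis using True by simp
  qed (use Suc.prems lower in auto)
qed

text \<open>
  The coefficient of \<open>a\<close> in the push-forward of \<open>x\<^sup>k \<partial>\<^sub>y\<close> by \<open>(x + a y, y)\<close> is
  \<open>x\<^sup>k \<partial>\<^sub>x - k x\<^sup>k\<^sup>-\<^sup>1 y \<partial>\<^sub>y\<close>; pushing it forward by \<open>(x, y + x\<^sup>2)\<close> adds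
  \<open>(k + 2) x\<^sup>k\<^sup>+\<^sup>1 \<partial>\<^sub>y\<close>.
\<close>

lemma vfields_monom:
  assumes "k \<ge> 2"
  shows "(\<lambda>z. (0, fst z ^ k)) \<in> vfields"
  using assms
proof (induction k rule: dec_induct)
  case base
  show ?case by (rule vfields_square)
next
  case (step k)
  \<comment> \<open>The coefficient of \<open>a ^ j\<close> in the push-forward
    \<open>(a * (x - a * y) ^ k, (x - a * y) ^ k)\<close>. The extra factor \<open>a\<close> shifts
    the index in the first component; at \<open>j = Suc k\<close> the second component vanishes with
    its binomial coefficient.\<close>
  define d where "d j z = (if j = 0 then 0 else of_nat (k choose (j - 1)) * (- snd z) ^ (j - 1) * fst z ^ (k - (j - 1)),
    of_nat (k choose j) * (- snd z) ^ j * fst z ^ (k - j))" for j and z :: plane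
  have "kmap a (0, fst (kmap (-a) z) ^ k) = (\<Sum>j\<le>Suc k. cscale (a ^ j) (d j z))" for a z
  proof -
    have binom: "(fst z - a * snd z) ^ k
      = (\<Sum>j\<le>k. a ^ j * (of_nat (k choose j) * (- snd z) ^ j * fst z ^ (k - j)))"
    proof -
      have "(fst z - a * snd z) ^ k = (a * (- snd z) + fst z) ^ k" by simp
      also have "\<dots> = (\<Sum>j\<le>k. of_nat (k choose j) * (a * (- snd z)) ^ j * fst z ^ (k - j))"
        by (rule binomial_ring)
      finally show ?thesis by (simp only: power_mult_distrib mult_ac)
    qed
    have "fst (\<Sum>j\<le>Suc k. cscale (a ^ j) (d j z)) = a * (fst z - a * snd z) ^ k"
      unfolding fst_sum sum.atMost_Suc_shift binom
      by (simp add: cscale_def d_def fst_sum sum_distrib_left mult_ac)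
    moreover have "snd (\<Sum>j\<le>Suc k. cscale (a ^ j) (d j z)) = (fst z - a * snd z) ^ k"
      unfolding snd_sum sum.atMost_Suc binom
      by (simp add: cscale_def d_def snd_sum binomial_eq_0)
    ultimately show ?thesis
      by (simp add: kmap_def prod_eq_iff)
  qed
  then have "(\<lambda>z. \<Sum>j\<le>Suc k. cscale (a ^ j) (d j z)) \<in> vfields" for a
    using vfields_kmap[OF step.IH, of a] by simp
  then have "d 1 \<in> vfields"
    by (rule vfields_coefficient) simp
  then have "(\<lambda>z. cscale (1 / of_nat (k + 2)) (hmap_deriv 1 (hmap (-1) z) (d 1 (hmap (-1) z)) + cscale (-1) (d 1 z))) \<in> vfields"
    by (intro vfields_scale vfields_add vfields_hmap)
  moreover have "cscale (1 / of_nat (k + 2)) (hmap_deriv 1 (hmap (-1) z) (d 1 (hmap (-1) z)) + cscale (-1) (d 1 z))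
    = (0, fst z ^ Suc k)" for z
  proof -
    have "of_nat (k + 2) \<noteq> (0 :: complex)" by (subst of_nat_eq_0_iff) simp
    moreover have "fst z ^ k = fst z * fst z ^ (k - 1)"
      using step.hyps by (metis Suc_diff_1 less_le_trans pos2 power_Suc)
    ultimately show ?thesis
      by (simp add: cscale_def d_def hmap_deriv_def hmap_def field_simps power2_eq_square)
  qed
  ultimately show ?case by simp
qed

lemma vfields_poly: "k \<ge> 2 \<Longrightarrow> (\<lambda>z. (0, fst z ^ k * poly q (fst z))) \<in> vfields"
proof (induction q arbitrary: k)
  case 0
  show ?case
    using vfields_scale[OF vfields_square, of 0] by (simp add: cscale_def)
next
  case (pCons c q)
  have "(\<lambda>z. cscale c (0, fst z ^ k) + (0, fst z ^ Suc k * poly q (fst z))) \<in> vfields"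
    by (intro vfields_add vfields_scale vfields_monom pCons.IH) (use pCons.prems in auto)
  then show ?case
    by (simp add: cscale_def algebra_simps)
qed

section \<open>Fields with prescribed values at finitely many points\<close>

lemma vfields_shear:
  "(\<lambda>z. cscale ((fst z - a * snd z) ^ 2 * poly q (fst z - a * snd z)) (a, 1)) \<in> vfields"
  \<comment> \<open>In the push-forward, \<open>kmap (-a)\<close> replaces \<open>x\<close> by
    \<open>x - a * y\<close> and \<open>kmap a\<close> turns the direction \<open>(0, 1)\<close>
    into \<open>(a, 1)\<close>.\<close>
  using vfields_kmap[OF vfields_poly[of 2 q], of a]
  by (simp add: kmap_def cscale_def mult_ac)

text \<open>Lagrange interpolation in the values of \<open>x - a * y\<close>. The point 0 is
  included in the injectivity assumption because shear coefficients carry the square of this form,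
  which must not vanish at \<open>b\<close>.\<close>

lemma vfields_interpolate_shear:
  assumes "finite B" "b \<in> B" "0 \<notin> B" "inj_on (\<lambda>z. fst z - a * snd z) (insert 0 B)"
  obtains V where "V \<in> vfields" "\<And>c. c \<in> B \<Longrightarrow> V c = (if c = b then (a, 1) else 0)"
proof -
  define l where "l z = fst z - a * snd z" for z :: plane
  define q where "q = (\<Prod>c\<in>B - {b}. [:- l c, 1:])"
  define V where "V z = cscale (1 / (l b ^ 2 * poly q (l b))) (cscale (l z ^ 2 * poly q (l z)) (a, 1))" for z
  have "l b \<noteq> l c" if "c \<in> B - {b}" for c
    using inj_onD[OF assms(4), of c b] assms(2) that by (auto simp: l_def)
  then have q: "poly q (l b) \<noteq> 0"
    using assms(1) by (force simp: q_def poly_prod)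
  have lb: "l b \<noteq> 0"
    using inj_onD[OF assms(4), of b 0] assms(2,3) by (auto simp: l_def)
  show ?thesis
  proof (rule that[of V])
    show "V \<in> vfields"
      unfolding V_def l_def by (intro vfields_scale vfields_shear)
    fix c assume "c \<in> B"
    then have "poly q (l c) = 0" if "c \<noteq> b"
      using assms(1) that by (auto simp: q_def poly_prod)
    then show "V c = (if c = b then (a, 1) else 0)"
      using q lb by (auto simp: V_def cscale_def zero_prod_def)
  qed
qed

text \<open>Two distinct points are identified for at most one \<open>a\<close>: if their second
  coordinates agree, the first ones differ and no \<open>a\<close> identifies them.\<close>

lemma finite_non_injective_projections:
  assumes "finite B"
  shows "finite {a. \<not> inj_on (\<lambda>z. fst z - a * snd z) (B :: plane set)}"
proof -
  have "{a. \<not> inj_on (\<lambda>z. fst z - a * snd z) B}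
    \<subseteq> (\<lambda>(c, d). (fst c - fst d) / (snd c - snd d)) ` (B \<times> B)"
  proof
    fix a assume "a \<in> {a. \<not> inj_on (\<lambda>z. fst z - a * snd z) B}"
    then obtain c d where cd: "c \<in> B" "d \<in> B" "c \<noteq> d" "fst c - a * snd c = fst d - a * snd d"
      by (auto simp: inj_on_def)
    then have "snd c - snd d \<noteq> 0" "fst c - fst d = a * (snd c - snd d)"
      by (auto simp: algebra_simps prod_eq_iff)
    then have "a = (fst c - fst d) / (snd c - snd d)" by (simp add: field_simps)
    then show "a \<in> (\<lambda>(c, d). (fst c - fst d) / (snd c - snd d)) ` (B \<times> B)"
      using cd by (auto intro!: image_eqI[of _ _ "(c, d)"])
  qed
  then show ?thesis
    by (rule finite_subset) (use assms in auto)
qed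

lemma vfields_interpolate:
  assumes "finite B" "b \<in> B" "0 \<notin> B"
  shows "\<exists>V\<in>vfields. \<forall>c\<in>B. V c = (if c = b then u else 0)"
proof -
  define bad where "bad = {a. \<not> inj_on (\<lambda>z. fst z - a * snd z) (insert 0 B)}"
  have "finite bad"
    unfolding bad_def using assms by (intro finite_non_injective_projections) auto
  then obtain a where a: "a \<notin> bad"
    using ex_new_if_finite infinite_UNIV_char_0 by blast
  \<comment> \<open>A second good slope makes \<open>(a, 1)\<close> and \<open>(a', 1)\<close> a
    basis; \<open>s\<close> and \<open>snd u - s\<close> are the coordinates of \<open>u\<close> in
    it.\<close>
  obtain a' where a': "a' \<notin> insert a bad"
    using \<open>finite bad\<close> ex_new_if_finite infinite_UNIV_char_0 by (metis finite_insert)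
  obtain V where V: "V \<in> vfields" "\<And>c. c \<in> B \<Longrightarrow> V c = (if c = b then (a, 1) else 0)"
    using vfields_interpolate_shear[OF assms, of a] a by (auto simp: bad_def)
  obtain V' where V': "V' \<in> vfields" "\<And>c. c \<in> B \<Longrightarrow> V' c = (if c = b then (a', 1) else 0)"
    using vfields_interpolate_shear[OF assms, of a'] a' by (auto simp: bad_def)
  define s where "s = (fst u - a' * snd u) / (a - a')"
  have ne: "a - a' \<noteq> 0" using a' by auto
  have "s * a + (snd u - s) * a' = s * (a - a') + snd u * a'" by (simp add: algebra_simps)
  also have "\<dots> = fst u" using ne by (simp add: s_def)
  finally have "cscale s (a, 1) + cscale (snd u - s) (a', 1) = u"
    by (simp add: cscale_def prod_eq_iff)
  then have "\<forall>c\<in>B. cscale s (V c) + cscale (snd u - s) (V' c) = (if c = b then u else 0)"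
    using V(2) V'(2) by (auto simp: cscale_def zero_prod_def)
  then show ?thesis
    using V(1) V'(1) by (intro bexI[of _ "\<lambda>z. cscale s (V z) + cscale (snd u - s) (V' z)"])
      (auto intro: vfields_add vfields_scale)
qed

section \<open>Infinite transitivity\<close>

lemma bounded_linear_apply_bcontfun: "bounded_linear (\<lambda>t. apply_bcontfun t i)"
  by (rule bounded_linear_intro[where K = 1]) (auto simp: norm_bounded)

lemma locally_transitive:
  fixes B :: "plane set"
  assumes B: "finite B" "0 \<notin> B"
  shows "\<exists>\<delta>>0. \<forall>q. (\<forall>b\<in>B. dist (q b) b < \<delta>) \<longrightarrow> (\<exists>g\<in>grp_maps. \<forall>b\<in>B. g b = q b)"
proof -
  obtain p where p: "bij_betw p {0..<card B} B"
    using ex_bij_betw_nat_finite[OF B(1)] by blast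
  define m where "m = card B"
  have pB: "p i \<in> B" if "i < m" for i
    using bij_betwE[OF p] that by (auto simp: m_def)
  have p_eq: "p i = p j \<longleftrightarrow> i = j" if "i < m" "j < m" for i j
    using inj_onD[OF bij_betw_imp_inj_on[OF p], of i j] that by (auto simp: m_def)
  have "\<forall>j u. \<exists>V. j < m \<longrightarrow> V \<in> vfields \<and> (\<forall>c\<in>B. V c = (if c = p j then u else 0))"
    using vfields_interpolate[OF B(1) pB B(2)] by blast
  then obtain V where V: "\<And>j u. j < m \<Longrightarrow> V j u \<in> vfields"
    "\<And>j u c. j < m \<Longrightarrow> c \<in> B \<Longrightarrow> V j u c = (if c = p j then u else 0)"
    by metis
  \<comment> \<open>Two complex parameters per point steer its two coordinates, so that
    \<open>L (p i) t\<close> is entry \<open>i\<close> of \<open>t\<close>. This is the derivative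
    that \<open>locally_onto\<close> asks for.\<close>
  define L where "L z t = (\<Sum>j<m. cscale (fst (apply_bcontfun t j)) (V j (1, 0) z)
    + cscale (snd (apply_bcontfun t j)) (V j (0, 1) z))" for z and t :: "nat \<Rightarrow>\<^sub>C plane"
  have fs: "bounded_linear (\<lambda>t. fst (apply_bcontfun t j))" "bounded_linear (\<lambda>t. snd (apply_bcontfun t j))" for j
    by (rule bounded_linear_compose[OF bounded_linear_fst bounded_linear_apply_bcontfun]
        bounded_linear_compose[OF bounded_linear_snd bounded_linear_apply_bcontfun])+
  have "velocity L"
    unfolding L_def
  proof (intro velocity_sum velocity_add)
    fix j assume "j \<in> {..<m}"
    then have "velocity (\<lambda>z t. cscale t (V j u z))" for u
      using V(1) by (simp add: vfields_def)
    from velocity_reparametrize[OF this fs(1)] velocity_reparametrize[OF this fs(2)]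
    show "velocity (\<lambda>z t. cscale (fst (apply_bcontfun t j)) (V j (1, 0) z))"
      "velocity (\<lambda>z t. cscale (snd (apply_bcontfun t j)) (V j (0, 1) z))" .
  qed simp
  then obtain F where F: "\<And>t. F t \<in> grp_maps" "F 0 = id"
    "\<And>z. has_strict_derivative (\<lambda>w. F (fst w) (snd w)) (\<lambda>h. snd h + L z (fst h)) (0, z)"
    unfolding velocity_def by blast
  have L: "L (p i) t = apply_bcontfun t i" if "i < m" for i t
  proof -
    have "L (p i) t = (\<Sum>j<m. if i = j then apply_bcontfun t j else 0)"
      unfolding L_def using that V(2) pB p_eq by (intro sum.cong) (auto simp: cscale_def zero_prod_def)
    then show ?thesis using that by simp
  qed
  have "has_strict_derivative (\<lambda>t. F t (p i)) (\<lambda>t. apply_bcontfun t i) 0" if "i < m" for i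
  proof -
    have "has_strict_derivative (\<lambda>t. (t, p i)) (\<lambda>h. (h, 0)) 0"
      by (intro has_strict_derivative_Pair has_strict_derivative_const has_strict_derivative_linear
          bounded_linear_ident)
    from has_strict_derivative_compose[OF this F(3)] show ?thesis
      by (simp add: L[OF that])
  qed
  then obtain \<delta> where \<delta>: "\<delta> > 0"
    "\<And>q. (\<And>i. i < m \<Longrightarrow> dist (q i) (F 0 (p i)) < \<delta>) \<Longrightarrow> \<exists>t. \<forall>i<m. F t (p i) = q i"
    using locally_onto[of m "\<lambda>i t. F t (p i)"] by blast
  show ?thesis
  proof (intro exI[of _ \<delta>] conjI allI impI)
    fix q assume q: "\<forall>b\<in>B. dist (q b) b < \<delta>"
    then obtain t where t: "\<forall>i<m. F t (p i) = q (p i)"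
      using \<delta>(2)[of "\<lambda>i. q (p i)"] pB F(2) by auto
    have "F t b = q b" if "b \<in> B" for b
    proof -
      have "b \<in> p ` {0..<m}"
        using that by (simp add: m_def bij_betw_imp_surj_on[OF p])
      then obtain i where "i < m" "b = p i" by auto
      then show ?thesis using t by simp
    qed
    then show "\<exists>g\<in>grp_maps. \<forall>b\<in>B. g b = q b" using F(1) by blast
  qed (rule \<delta>)
qed

text \<open>Being related by a group element that fixes \<open>A\<close> pointwise is an equivalence
  relation on the complement of \<open>insert 0 A\<close>. Its classes are open by
  \<open>locally_transitive\<close>, so connectedness leaves only one.\<close>

lemma move_one_point:
  fixes A :: "plane set"
  assumes A: "finite A" "0 \<notin> A" and zw: "z \<notin> insert 0 A" "w \<notin> insert 0 A"
  shows "\<exists>g\<in>grp_maps. (\<forall>a\<in>A. g a = a) \<and> g z = w"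
proof -
  define S where "S = - insert 0 A"
  define R where "R z w \<longleftrightarrow> (\<exists>g\<in>grp_maps. (\<forall>a\<in>A. g a = a) \<and> g z = w)" for z w
  have S: "open S" "connected S"
  proof -
    show "open S"
      unfolding S_def using A by (intro open_Compl finite_imp_closed) auto
    show "connected S"
      unfolding S_def using A
      by (intro path_connected_imp_connected path_connected_complement_countable) (auto intro: countable_finite)
  qed
  have "R z w"
  proof (rule connected_equivalence_relation[OF S(2)])
    show "z \<in> S" "w \<in> S" using zw by (auto simp: S_def)
    show "R y x" if xy: "R x y" for x y
    proof -
      obtain g where g: "g \<in> grp_maps" "\<forall>a\<in>A. g a = a" "g x = y"
        using xy by (auto simp: R_def)
      obtain h where h: "h \<in> grp_maps" "h \<circ> g = id"
        using inverse_grp_maps[OF g(1)] by blast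
      have "h (g v) = v" for v using h(2) by (metis comp_apply id_apply)
      then show ?thesis using g h(1) unfolding R_def by metis
    qed
    show "R x v" if "R x y" "R y v" for x y v
    proof -
      obtain g h where "g \<in> grp_maps" "\<forall>a\<in>A. g a = a" "g x = y"
          "h \<in> grp_maps" "\<forall>a\<in>A. h a = a" "h y = v"
        using \<open>R x y\<close> \<open>R y v\<close> by (auto simp: R_def)
      then show ?thesis
        unfolding R_def by (intro bexI[of _ "h \<circ> g"]) (auto intro: comp_grp_maps)
    qed
    fix a assume a: "a \<in> S"
    obtain \<delta> where \<delta>: "\<delta> > 0"
      "\<And>q. \<forall>b\<in>insert a A. dist (q b) b < \<delta> \<Longrightarrow> \<exists>g\<in>grp_maps. \<forall>b\<in>insert a A. g b = q b"
      using locally_transitive[of "insert a A"] A a unfolding S_def by auto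
    show "\<exists>T. openin (top_of_set S) T \<and> a \<in> T \<and> (\<forall>x\<in>T. R a x)"
    proof (intro exI[of _ "S \<inter> ball a \<delta>"] conjI ballI)
      show "openin (top_of_set S) (S \<inter> ball a \<delta>)" by (rule openin_open_Int) simp
      show "a \<in> S \<inter> ball a \<delta>" using a \<delta> by simp
      fix x assume x: "x \<in> S \<inter> ball a \<delta>"
      have aA: "a \<notin> A" using a by (auto simp: S_def)
      \<comment> \<open>The prescribed displacement moves \<open>a\<close> to \<open>x\<close> and
        leaves \<open>A\<close> alone.\<close>
      then have "\<forall>b\<in>insert a A. dist ((if b = a then x else b)) b < \<delta>"
        using x \<delta>(1) by (auto simp: dist_commute)
      from \<delta>(2)[OF this] show "R a x"
        unfolding R_def using aA by (metis insertCI)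
    qed
  qed
  then show ?thesis by (simp add: R_def)
qed

text \<open>If \<open>g\<close> already matches all entries but the last, \<open>h\<close> corrects
  the last one while fixing the targets reached so far. Injectivity of \<open>g\<close> keeps
  \<open>g x\<close> away from these targets and from the origin.\<close>

lemma grp_maps_transitive_on_lists:
  assumes "length xs = length ys" "distinct xs" "distinct ys" "0 \<notin> set xs" "0 \<notin> set ys"
  shows "\<exists>g\<in>grp_maps. map g xs = ys"
  using assms
proof (induction xs arbitrary: ys rule: rev_induct)
  case Nil
  then show ?case by (intro bexI[of _ id]) simp_all
next
  case (snoc x xs)
  obtain ys' y where ys: "ys = ys' @ [y]"
    using snoc.prems(1) by (cases ys rule: rev_cases) auto
  then obtain g where g: "g \<in> grp_maps" "map g xs = ys'"
    using snoc.IH[of ys'] snoc.prems by auto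
  have "inj g" using grp_maps_bij[OF g(1)] by (rule bij_is_inj)
  have "g x \<noteq> 0"
    using snoc.prems(4) grp_maps_fix_0[OF g(1)] \<open>inj g\<close> by (auto dest: injD[of g x 0])
  moreover have "g x \<notin> set ys'"
    using snoc.prems(2) unfolding g(2)[symmetric] set_map inj_image_mem_iff[OF \<open>inj g\<close>] by simp
  ultimately obtain h where h: "h \<in> grp_maps" "\<forall>a\<in>set ys'. h a = a" "h (g x) = y"
    using move_one_point[of "set ys'" "g x" y] snoc.prems ys by auto
  then have "map h ys' = ys'" by (simp add: map_idI)
  then have "map (h \<circ> g) (xs @ [x]) = ys"
    using g(2) h(3) ys by (metis comp_apply list.simps(8,9) map_append map_map)
  then show ?case using comp_grp_maps[OF h(1) g(1)] by blast
qed

section \<open>Orbits, and which of them is Zariski open\<close>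

lemma orbits_grp_H2_K1: "orbits grp_H2_K1 UNIV act = {{0}, - {0}}"
proof -
  have orb: "w \<in> orbit grp_H2_K1 act z \<longleftrightarrow> (\<exists>g\<in>grp_maps. g z = w)" for z w
    by (auto simp: orbit_def grp_maps_def)
  have "orbit grp_H2_K1 act 0 = {0}"
  proof (rule Set.set_eqI)
    show "w \<in> orbit grp_H2_K1 act 0 \<longleftrightarrow> w \<in> {0}" for w
      unfolding orb using grp_maps_fix_0 id_grp_maps by (metis singleton_iff)
  qed
  moreover have "orbit grp_H2_K1 act z = - {0}" if "z \<noteq> 0" for z
  proof (rule Set.set_eqI)
    fix w
    have "g z \<noteq> 0" if "g \<in> grp_maps" for g
      using \<open>z \<noteq> 0\<close> grp_maps_fix_0[OF that] bij_is_inj[OF grp_maps_bij[OF that]] by (metis injD)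
    \<comment> \<open>With no points to be fixed, \<open>move_one_point\<close> is transitivity on
      the punctured plane.\<close>
    moreover have "\<exists>g\<in>grp_maps. g z = w" if "w \<noteq> 0"
      using move_one_point[of "{}" z w] \<open>z \<noteq> 0\<close> that by auto
    ultimately show "w \<in> orbit grp_H2_K1 act z \<longleftrightarrow> w \<in> - {0}"
      unfolding orb Compl_iff singleton_iff by metis
  qed
  ultimately have orbit: "orbit grp_H2_K1 act z = (if z = 0 then {0} else - {0})" for z
    by simp
  have "range (\<lambda>z :: plane. if z = 0 then {0} else - {0}) = {{0}, - {0}}"
  proof
    show "{{0}, - {0}} \<subseteq> range (\<lambda>z :: plane. if z = 0 then {0} else - {0})"
      using rangeI[of "\<lambda>z :: plane. if z = 0 then {0} else - {0}" 0]
        rangeI[of "\<lambda>z :: plane. if z = 0 then {0} else - {0}" "(1, 1)"]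
      by (simp add: prod_eq_iff)
  qed (simp add: image_subset_iff)
  then show ?thesis
    by (simp only: orbits_def orbit full_SetCompr_eq UNIV_I simp_thms)
qed

lemma zariski_open_punctured: "zariski_open (- {0})"
  unfolding zariski_open_def zariski_closed_def
  by (rule exI[of _ "{varX, varY}"]) (auto simp: prod_eq_iff)

text \<open>A polynomial \<open>p\<close> that vanishes exactly off the origin would make
  \<open>p * varX\<close> vanish everywhere, which is impossible in an integral domain unless
  \<open>p = 0\<close>.\<close>

lemma not_zariski_open_origin: "\<not> zariski_open {0}"
proof
  assume "zariski_open {0}"
  then obtain P :: "bipoly set" where P: "- {0} = {z. \<forall>p\<in>P. eval2 p z = 0}"
    by (auto simp: zariski_open_def zariski_closed_def)
  then obtain p where p: "p \<in> P" "eval2 p 0 \<noteq> 0" by blast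
  have "eval2 (p * varX) z = eval2 0 z" for z
    using P p(1) by (cases "z = 0") auto
  then have "p * varX = 0" by (rule eval2_inject)
  then have "p = 0" by (simp add: varX_def)
  then show False using p(2) by simp
qed

lemma open_orbit_grp_H2_K1_iff: "open_orbit grp_H2_K1 S \<longleftrightarrow> S = - {0}"
  using zariski_open_punctured not_zariski_open_origin
  by (auto simp: open_orbit_def orbits_grp_H2_K1)

lemma group_action_distinct_tuples:
  "group_action grp_H2_K1 (distinct_tuples m (- {0}))
     (\<lambda>g. restrict (map (act g)) (distinct_tuples m (- {0})))"
proof -
  define D where "D = distinct_tuples m (- {0 :: plane})"
  define \<phi> where "\<phi> g = restrict (map (act g)) D" for g
  interpret group grp_H2_K1 by (rule group_grp_H2_K1)
  have maps: "map g xs \<in> D" if "g \<in> grp_maps" "xs \<in> D" for g xs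
  proof -
    have "inj g" using grp_maps_bij[OF that(1)] by (rule bij_is_inj)
    moreover have "g x \<noteq> 0" if "x \<noteq> 0" for x
      using that \<open>inj g\<close> grp_maps_fix_0[OF \<open>g \<in> grp_maps\<close>] by (metis injD)
    ultimately show ?thesis
      using that(2) unfolding D_def distinct_tuples_def
      by (force simp: distinct_map intro: inj_on_subset)
  qed
  have Bij: "\<phi> F \<in> Bij D" if "F \<in> carrier grp_H2_K1" for F
  proof -
    have F: "act F \<in> grp_maps" using that by (simp add: grp_maps_def)
    obtain h where h: "h \<in> grp_maps" "h \<circ> act F = id" "act F \<circ> h = id"
      using inverse_grp_maps[OF F] by blast
    have "bij_betw (map (act F)) D D"
      by (rule bij_betw_byWitness[where f' = "map h"]) (use h F maps in auto)
    then show ?thesis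
      by (simp add: \<phi>_def Bij_def bij_betw_restrict_eq)
  qed
  have "\<phi> \<in> hom grp_H2_K1 (BijGroup D)"
  proof (rule homI)
    fix F G assume FG: "F \<in> carrier grp_H2_K1" "G \<in> carrier grp_H2_K1"
    show "\<phi> (F \<otimes>\<^bsub>grp_H2_K1\<^esub> G) = \<phi> F \<otimes>\<^bsub>BijGroup D\<^esub> \<phi> G"
    proof
      fix xs
      have "act G \<in> grp_maps" using FG(2) by (simp add: grp_maps_def)
      then have "map (act G) xs \<in> D" if "xs \<in> D" using maps that by blast
      \<comment> \<open>Outside \<open>D\<close> both sides are \<open>undefined\<close>, as
        restricted functions. Membership in \<open>Bij D\<close> is needed because the product of
        \<open>BijGroup D\<close> is itself restricted to that set.\<close>
      then show "\<phi> (F \<otimes>\<^bsub>grp_H2_K1\<^esub> G) xs = (\<phi> F \<otimes>\<^bsub>BijGroup D\<^esub> \<phi> G) xs"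
        using Bij[OF FG(1)] Bij[OF FG(2)]
        by (cases "xs \<in> D") (simp_all add: BijGroup_def compose_def \<phi>_def)
    qed
  qed (simp add: Bij BijGroup_def)
  then show ?thesis
    unfolding D_def \<phi>_def
    by (intro group_action.intro group_hom.intro group_hom_axioms.intro group_BijGroup is_group)
qed

text \<open>Unique existence justifies speaking of the open orbit and keeps the second conjunct from
  being vacuous.\<close>

theorem corollary21:
  shows "(\<exists>!S. open_orbit grp_H2_K1 S) \<and>
         (\<forall>S. open_orbit grp_H2_K1 S \<longrightarrow> infinitely_transitive grp_H2_K1 act S)"
proof -
  have "infinitely_transitive grp_H2_K1 act (- {0})"
    unfolding infinitely_transitive_def
  proof (intro allI impI transitive_action.intro transitive_action_axioms.intro
      group_action_distinct_tuples)
    fix m :: nat and xs ys :: "plane list"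
    assume xy: "xs \<in> distinct_tuples m (- {0})" "ys \<in> distinct_tuples m (- {0})"
    then obtain g where "g \<in> grp_maps" "map g xs = ys"
      using grp_maps_transitive_on_lists[of xs ys] by (auto simp: distinct_tuples_def)
    then show "\<exists>g\<in>carrier grp_H2_K1. restrict (map (act g)) (distinct_tuples m (- {0})) xs = ys"
      using xy(1) by (auto simp: grp_maps_def)
  qed
  then show ?thesis
    by (simp add: open_orbit_grp_H2_K1_iff)
qed

end
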